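(* Let $N\ge1$, $M_L,M_R\in\mathbb{R}^{N\times N}$, $\mu\in\mathbb{R}$, $\zeta=(\mu,0,\dots,0)^T\in\mathbb{R}^N$, and let $G_\mu:\mathbb{R}^N\to\mathbb{R}^N$ be the map $$G_\mu(X)=\begin{cases} M_LX+\zeta, & x_1\le 0,\\ M_RX+\zeta, & x_1>0,\end{cases}\qquad X=(x_1,\dots,x_N)^T,$$ where $M_L$ and $M_R$ are in normal form. Let $m,n\ge 1$ be integers and suppose that $X_0,X_1,\dots,X_{m+n-1}$ is an $L^mR^n$ periodic orbit of $G_\mu$: $X_{i+1}=G_\mu(X_i)$ for $0\le i\le m+n-2$, $G_\mu(X_{m+n-1})=X_0$, the points $X_0,\dots,X_{n-1}$ have first coordinate $>0$, and the points $X_n,\dots,X_{m+n-1}$ have first coordinate $\le 0$. If the matrix $I-M_L^mM_R^n$ is invertible, then $$X_0=\left(I-M_L^mM_R^n\right)^{-1}\left(M_L^m\,\phi_{R,n}+\phi_{L,m}\right)\zeta .$$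
   Context: $I$ is the $N\times N$ identity matrix. For $J\in\{L,R\}$ and $k\ge1$, $\phi_{J,k}=I+M_J+M_J^2+\dots+M_J^{k-1}$. A matrix $M_J$ is in normal form if, for some real numbers $\rho^{(J)}_1,\dots,\rho^{(J)}_N$, its first column is $\left(\rho^{(J)}_1,-\rho^{(J)}_2,\dots,(-1)^{N-1}\rho^{(J)}_N\right)^T$, its superdiagonal entries (positions $(i,i+1)$) are all $1$, and all its other entries are $0$. *)

theory Defs
  imports Complex_Main "Jordan_Normal_Form.Matrix"
begin

text \<open>
  Vectors and matrices are those of the Jordan normal form library, so the dimension \<open>N\<close> is a natural
  number. Indices start at \<open>0\<close>: the coordinate $x_1$ is \<open>X $ 0\<close> and the matrix position
  $(i,j)$ is \<open>(i - 1, j - 1)\<close>.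
\<close>

definition normal_form :: "nat \<Rightarrow> real mat \<Rightarrow> bool" where
  "normal_form N M \<longleftrightarrow> M \<in> carrier_mat N N \<and>
     (\<exists>\<rho> :: nat \<Rightarrow> real. \<forall>i < N. \<forall>j < N.
        M $$ (i, j) = (if j = 0 then (- 1) ^ i * \<rho> (Suc i)
                       else if j = Suc i then 1
                       else 0))"

definition \<zeta>_vec :: "nat \<Rightarrow> real \<Rightarrow> real vec" where
  "\<zeta>_vec N \<mu> = vec N (\<lambda>i. if i = 0 then \<mu> else 0)"

definition G_map :: "nat \<Rightarrow> real mat \<Rightarrow> real mat \<Rightarrow> real \<Rightarrow> real vec \<Rightarrow> real vec" where
  "G_map N M\<^sub>L M\<^sub>R \<mu> X =
     (if X $ 0 \<le> 0 then M\<^sub>L *\<^sub>v X + \<zeta>_vec N \<mu> else M\<^sub>R *\<^sub>v X + \<zeta>_vec N \<mu>)"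

definition geom_sum_mat :: "nat \<Rightarrow> real mat \<Rightarrow> nat \<Rightarrow> real mat" where
  "geom_sum_mat N M k = finsum (ring_mat TYPE(real) N ()) (\<lambda>l. M ^\<^sub>m l) {..<k}"

definition mat_inv :: "nat \<Rightarrow> real mat \<Rightarrow> real mat" where
  "mat_inv N A = m_inv (ring_mat TYPE(real) N ()) A"

definition LmRn_periodic_orbit ::
    "nat \<Rightarrow> real mat \<Rightarrow> real mat \<Rightarrow> real \<Rightarrow> nat \<Rightarrow> nat \<Rightarrow> (nat \<Rightarrow> real vec) \<Rightarrow> bool" where
  "LmRn_periodic_orbit N M\<^sub>L M\<^sub>R \<mu> m n X \<longleftrightarrow>
     (\<forall>i < m + n. X i \<in> carrier_vec N) \<and>
     (\<forall>i. Suc i < m + n \<longrightarrow> X (Suc i) = G_map N M\<^sub>L M\<^sub>R \<mu> (X i)) \<and>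
     G_map N M\<^sub>L M\<^sub>R \<mu> (X (m + n - 1)) = X 0 \<and>
     (\<forall>i < n. X i $ 0 > 0) \<and>
     (\<forall>i. n \<le> i \<and> i < m + n \<longrightarrow> X i $ 0 \<le> 0)"

end

theory Submission
  imports Defs
begin

text \<open>
  Iterating the affine map \<open>y \<mapsto> M y + z\<close> \<open>k\<close> times gives
  \<open>y \<mapsto> M\<^sup>k y + \<phi>\<^sub>k z\<close>. Doing this \<open>n\<close> times with \<open>M\<^sub>R\<close> and then \<open>m\<close> times with
  \<open>M\<^sub>L\<close> must return to \<open>X\<^sub>0\<close>, which is the linear equation
  \<open>(I - M\<^sub>L\<^sup>m M\<^sub>R\<^sup>n) X\<^sub>0 = (M\<^sub>L\<^sup>m \<phi>\<^sub>R\<^sub>,\<^sub>n + \<phi>\<^sub>L\<^sub>,\<^sub>m) \<zeta>\<close>.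
\<close>

lemma geom_sum_mat_carrier [simp]:
  assumes "M \<in> carrier_mat N N"
  shows "geom_sum_mat N M k \<in> carrier_mat N N"
proof -
  interpret R: ring "ring_mat TYPE(real) N ()" by (rule ring_mat)
  have "(\<lambda>l. M ^\<^sub>m l) \<in> {..<k} \<rightarrow> carrier (ring_mat TYPE(real) N ())"
    using assms by (auto simp: ring_mat_simps)
  from R.finsum_closed[OF this] show ?thesis
    by (simp add: geom_sum_mat_def ring_mat_simps)
qed

lemma geom_sum_mat_0: "geom_sum_mat N M 0 = 0\<^sub>m N N"
proof -
  interpret R: ring "ring_mat TYPE(real) N ()" by (rule ring_mat)
  show ?thesis by (simp add: geom_sum_mat_def ring_mat_simps)
qed

lemma geom_sum_mat_Suc:
  assumes "M \<in> carrier_mat N N"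
  shows "geom_sum_mat N M (Suc k) = M ^\<^sub>m k + geom_sum_mat N M k"
proof -
  interpret R: ring "ring_mat TYPE(real) N ()" by (rule ring_mat)
  have "(\<lambda>l. M ^\<^sub>m l) \<in> {..<k} \<rightarrow> carrier (ring_mat TYPE(real) N ())"
    and "M ^\<^sub>m k \<in> carrier (ring_mat TYPE(real) N ())"
    using assms by (auto simp: ring_mat_simps)
  then show ?thesis
    unfolding geom_sum_mat_def lessThan_Suc
    by (subst R.finsum_insert) (auto simp: ring_mat_simps)
qed

text \<open>Induction on \<open>k\<close> that peels off the first step rather than the last: the
  hypothesis is applied to the shifted sequence starting at \<open>Y (Suc 0)\<close>. Expanding
  \<open>M *\<^sub>v Y 0 + z\<close> under \<open>M ^\<^sub>m k\<close> raises the power by one and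
  leaves \<open>M ^\<^sub>m k *\<^sub>v z\<close>, exactly the term that
  \<open>geom_sum_mat_Suc\<close> adds. The recurrence is assumed only below \<open>k\<close>, so
  the lemma fits a finite stretch of an orbit.\<close>

lemma affine_iterate:
  assumes "M \<in> carrier_mat N N" "z \<in> carrier_vec N" "Y 0 \<in> carrier_vec N"
    and "\<And>i. i < k \<Longrightarrow> Y (Suc i) = M *\<^sub>v Y i + z"
  shows "Y k = M ^\<^sub>m k *\<^sub>v Y 0 + geom_sum_mat N M k *\<^sub>v z"
  using assms
proof (induction k arbitrary: Y)
  case 0
  then have "0\<^sub>m N N *\<^sub>v z = 0\<^sub>v N" by (intro eq_vecI) auto
  with 0 show ?case by (simp add: geom_sum_mat_0)
next
  case (Suc k)
  note M = Suc.prems(1) and z = Suc.prems(2) and Y0 = Suc.prems(3)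
  have Mk: "M ^\<^sub>m k \<in> carrier_mat N N" and MY: "M *\<^sub>v Y 0 \<in> carrier_vec N"
    and \<phi>: "geom_sum_mat N M k \<in> carrier_mat N N"
    using M Y0 by auto
  have Y1: "Y (Suc 0) = M *\<^sub>v Y 0 + z"
    using Suc.prems(4) by simp
  have "Y (Suc k) = M ^\<^sub>m k *\<^sub>v Y (Suc 0) + geom_sum_mat N M k *\<^sub>v z"
    using Suc.IH[of "\<lambda>i. Y (Suc i)"] Suc.prems Y1 MY by simp
  also have "\<dots> = (M ^\<^sub>m k *\<^sub>v (M *\<^sub>v Y 0) + M ^\<^sub>m k *\<^sub>v z) + geom_sum_mat N M k *\<^sub>v z"
    using mult_add_distrib_mat_vec[OF Mk MY z] Y1 by simp
  also have "\<dots> = M ^\<^sub>m k *\<^sub>v (M *\<^sub>v Y 0) + (M ^\<^sub>m k *\<^sub>v z + geom_sum_mat N M k *\<^sub>v z)"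
    using Mk MY z \<phi> by (intro assoc_add_vec[of _ N]) auto
  also have "\<dots> = M ^\<^sub>m Suc k *\<^sub>v Y 0 + geom_sum_mat N M (Suc k) *\<^sub>v z"
    using assoc_mult_mat_vec[OF Mk M Y0] add_mult_distrib_mat_vec[OF Mk \<phi> z]
    by (simp add: geom_sum_mat_Suc[OF M])
  finally show ?case .
qed

text \<open>\<open>mat_inv\<close> is the ring-theoretic \<open>m_inv\<close>, a definite
  description that is meaningful on units. The work is to turn \<open>invertible_mat A\<close> into
  membership in \<open>Units\<close>; then multiplying the equation by the inverse on the left
  isolates \<open>x\<close>.\<close>

lemma mat_inv_mult_vec_eqI:
  assumes A: "A \<in> carrier_mat N N" and "invertible_mat A"
    and x: "x \<in> carrier_vec N" and "A *\<^sub>v x = b"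
  shows "x = mat_inv N A *\<^sub>v b"
proof -
  interpret R: ring "ring_mat TYPE(real) N ()" by (rule ring_mat)
  obtain B where AB: "A * B = 1\<^sub>m (dim_row A)" and BA: "B * A = 1\<^sub>m (dim_row B)"
    using assms(2) by (auto simp: invertible_mat_def inverts_mat_def)
  \<comment> \<open>The witness \<open>B\<close> comes without a size; comparing column counts in
    the two inverse equations shows that it is square of size \<open>N\<close>.\<close>
  have "dim_col B = N" "dim_row B = N"
    using arg_cong[OF AB, of dim_col] arg_cong[OF BA, of dim_col] A by auto
  then have "B \<in> carrier_mat N N" by auto
  then have "A \<in> Units (ring_mat TYPE(real) N ())"
    using A AB BA unfolding Units_def by (auto simp: ring_mat_simps)
  then have "mat_inv N A \<in> carrier_mat N N" "mat_inv N A * A = 1\<^sub>m N"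
    using R.Units_inv_closed R.Units_l_inv by (auto simp: mat_inv_def ring_mat_simps)
  then show ?thesis
    using assoc_mult_mat_vec[of "mat_inv N A" N N A N x] A x assms(4) by simp
qed

theorem mainTheorem2:
  fixes N m n :: nat
    and M\<^sub>L M\<^sub>R :: "real mat"
    and \<mu> :: real
    and X :: "nat \<Rightarrow> real vec"
  assumes "N \<ge> 1"
    and "normal_form N M\<^sub>L"
    and "normal_form N M\<^sub>R"
    and "m \<ge> 1"
    and "n \<ge> 1"
    and "LmRn_periodic_orbit N M\<^sub>L M\<^sub>R \<mu> m n X"
    and "invertible_mat (1\<^sub>m N - M\<^sub>L ^\<^sub>m m * M\<^sub>R ^\<^sub>m n)"
  shows "X 0 = mat_inv N (1\<^sub>m N - M\<^sub>L ^\<^sub>m m * M\<^sub>R ^\<^sub>m n)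
           *\<^sub>v ((M\<^sub>L ^\<^sub>m m * geom_sum_mat N M\<^sub>R n + geom_sum_mat N M\<^sub>L m) *\<^sub>v \<zeta>_vec N \<mu>)"
proof -
  define z where "z = \<zeta>_vec N \<mu>"
  have z: "z \<in> carrier_vec N" by (simp add: z_def \<zeta>_vec_def)
  have L_carrier: "M\<^sub>L \<in> carrier_mat N N" and R_carrier: "M\<^sub>R \<in> carrier_mat N N"
    using assms(2,3) by (auto simp: normal_form_def)
  note orbit = assms(6)[unfolded LmRn_periodic_orbit_def G_map_def, folded z_def]
  \<comment> \<open>The orbit predicate says nothing about \<open>X (m + n)\<close>. Setting that
    entry to \<open>X 0\<close> closes the cycle, so the wrap-around becomes an ordinary last step
    of the left phase.\<close>
  define Y where "Y i = (if i = m + n then X 0 else X i)" for i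
  have X: "X 0 \<in> carrier_vec N" "X n \<in> carrier_vec N"
    using orbit assms(4) by auto
  have right: "X n = M\<^sub>R ^\<^sub>m n *\<^sub>v X 0 + geom_sum_mat N M\<^sub>R n *\<^sub>v z"
  proof (rule affine_iterate[OF R_carrier z, where Y = X, OF X(1)])
    fix i assume "i < n"
    \<comment> \<open>Since \<open>m\<close> is at least 1, even the step from \<open>n - 1\<close>
      to \<open>n\<close> stays inside the list, so no right step wraps around.\<close>
    then have "X i $ 0 > 0" "Suc i < m + n" using orbit assms(4) by auto
    then show "X (Suc i) = M\<^sub>R *\<^sub>v X i + z" using orbit by auto
  qed
  have left: "Y (n + m) = M\<^sub>L ^\<^sub>m m *\<^sub>v Y (n + 0) + geom_sum_mat N M\<^sub>L m *\<^sub>v z"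
  proof (rule affine_iterate[OF L_carrier z, where Y = "\<lambda>i. Y (n + i)"])
    show "Y (n + 0) \<in> carrier_vec N" using X by (simp add: Y_def)
    fix i assume i: "i < m"
    then have neg: "X (n + i) $ 0 \<le> 0" using orbit by auto
    show "Y (n + Suc i) = M\<^sub>L *\<^sub>v Y (n + i) + z"
    \<comment> \<open>The last left step uses the closing equation of the orbit; all earlier ones
      use its recurrence.\<close>
    proof (cases "Suc i = m")
      case True
      then have "m + n - 1 = n + i" by simp
      then show ?thesis using True neg orbit by (auto simp: Y_def add.commute)
    next
      case False
      then have "Suc (n + i) < m + n" using i by simp
      then have "X (Suc (n + i)) = M\<^sub>L *\<^sub>v X (n + i) + z" using neg orbit by auto
      then show ?thesis using False i by (auto simp: Y_def)
    qed
  qed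
  define P where "P = M\<^sub>L ^\<^sub>m m"
  define Q where "Q = M\<^sub>R ^\<^sub>m n"
  define S where "S = geom_sum_mat N M\<^sub>R n"
  define T where "T = geom_sum_mat N M\<^sub>L m"
  have carr: "P \<in> carrier_mat N N" "Q \<in> carrier_mat N N"
    "S \<in> carrier_mat N N" "T \<in> carrier_mat N N"
    using L_carrier R_carrier by (auto simp: P_def Q_def S_def T_def)
  \<comment> \<open>The right phase is substituted into the left one, with
    \<open>Y (n + m) = X 0\<close> and, as \<open>m\<close> is positive,
    \<open>Y (n + 0) = X n\<close>.\<close>
  have "X 0 = P *\<^sub>v (Q *\<^sub>v X 0 + S *\<^sub>v z) + T *\<^sub>v z"
    using left right assms(4) by (auto simp: Y_def P_def Q_def S_def T_def add.commute)
  also have "P *\<^sub>v (Q *\<^sub>v X 0 + S *\<^sub>v z) = P *\<^sub>v (Q *\<^sub>v X 0) + P *\<^sub>v (S *\<^sub>v z)"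
    using carr X z by (intro mult_add_distrib_mat_vec[of _ N N]) auto
  also have "\<dots> = (P * Q) *\<^sub>v X 0 + (P * S) *\<^sub>v z"
    using carr X z by (simp add: assoc_mult_mat_vec[of _ N N _ N])
  also have "\<dots> + T *\<^sub>v z = (P * Q) *\<^sub>v X 0 + ((P * S) *\<^sub>v z + T *\<^sub>v z)"
    using carr X z by (intro assoc_add_vec[of _ N]) (auto intro!: mult_mat_vec_carrier)
  also have "(P * S) *\<^sub>v z + T *\<^sub>v z = (P * S + T) *\<^sub>v z"
    using carr z by (intro add_mult_distrib_mat_vec[symmetric]) auto
  finally have fixpoint: "X 0 = (P * Q) *\<^sub>v X 0 + (P * S + T) *\<^sub>v z" .
  have "(1\<^sub>m N - P * Q) *\<^sub>v X 0 = X 0 - (P * Q) *\<^sub>v X 0"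
    using carr X minus_mult_distrib_mat_vec[of "1\<^sub>m N" N N "P * Q" "X 0"] by simp
  also have "\<dots> = (P * S + T) *\<^sub>v z"
  \<comment> \<open>The term is moved across the equation coordinatewise; without
    \<open>index_mult_mat_vec\<close> the products stay opaque instead of expanding into scalar
    products.\<close>
  proof (rule eq_vecI)
    fix i assume "i < dim_vec ((P * S + T) *\<^sub>v z)"
    then have "i < N" using carr by auto
    then have "X 0 $ i = ((P * Q) *\<^sub>v X 0) $ i + ((P * S + T) *\<^sub>v z) $ i"
      using arg_cong[OF fixpoint, of "\<lambda>w. w $ i"] \<open>i < N\<close> carr
      by (auto simp del: index_mult_mat_vec)
    then show "(X 0 - (P * Q) *\<^sub>v X 0) $ i = ((P * S + T) *\<^sub>v z) $ i"
      using \<open>i < N\<close> carr X by (auto simp del: index_mult_mat_vec)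
  qed (use carr in auto)
  finally have "(1\<^sub>m N - P * Q) *\<^sub>v X 0 = (P * S + T) *\<^sub>v z" .
  moreover have "1\<^sub>m N - P * Q \<in> carrier_mat N N"
    using carr by (intro minus_carrier_mat mult_carrier_mat)
  ultimately have "X 0 = mat_inv N (1\<^sub>m N - P * Q) *\<^sub>v ((P * S + T) *\<^sub>v z)"
    using assms(7) X(1) by (intro mat_inv_mult_vec_eqI) (simp_all add: P_def Q_def)
  then show ?thesis
    by (simp only: P_def Q_def S_def T_def z_def)
qed

end
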